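(* Let $\alpha>0$ be a non-integer real number and $m=\lceil\alpha\rceil$. Let $a\neq0$ be a real number and $x>a$. Then $${}_aI_x^{\alpha}\,e^{-\frac{x^2}{2}}=(x-a)^{\alpha}\sum_{n=0}^{\infty}\frac{(-1)^n(2n)!}{2^n\,n!}\left(\sum_{k=0}^{2n}\frac{a^{2n-k}(x-a)^k}{(2n-k)!\,\Gamma(\alpha+k+1)}\right),$$ $${}_aD_x^{\alpha}\,e^{-\frac{x^2}{2}}=(x-a)^{-\alpha}\sum_{n=0}^{\infty}\frac{(-1)^n(2n)!}{2^n\,n!}\left(\sum_{k=0}^{2n}\frac{a^{2n-k}(x-a)^k}{(2n-k)!\,\Gamma(k-\alpha+1)}\right),$$ $$a^{m}(x-a)^{\alpha-m}\;{}_a^{C}D_x^{\alpha}\,e^{-\frac{x^2}{2}}=\sum_{n=0}^{\infty}\frac{(-1)^n(2n)!}{2^n\,n!}\left(\sum_{k=0}^{2n-m}\frac{a^{2n-k}(x-a)^k}{(2n-m-k)!\,\Gamma(m-\alpha+k+1)}\right).$$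
   Context: Throughout, $\alpha>0$ is a non-integer real number and $m=\lceil\alpha\rceil$. For a function $f$ and $x>a$: the left-sided Riemann-Liouville fractional integral of order $\alpha$ is ${}_aI_x^{\alpha}f(x)=\frac{1}{\Gamma(\alpha)}\int_a^x(x-\tau)^{\alpha-1}f(\tau)\,d\tau$; the left-sided Riemann-Liouville fractional derivative of order $\alpha$ is ${}_aD_x^{\alpha}f(x)=\frac{1}{\Gamma(m-\alpha)}\frac{d^m}{dx^m}\int_a^x(x-\tau)^{m-\alpha-1}f(\tau)\,d\tau$; the left-sided Caputo fractional derivative of order $\alpha$ is ${}_a^{C}D_x^{\alpha}f(x)=\frac{1}{\Gamma(m-\alpha)}\int_a^x(x-\tau)^{m-\alpha-1}f^{(m)}(\tau)\,d\tau$. Notation such as ${}_aI_x^{\alpha}\,e^{-x^2/2}$ means the operator applied to the function $\tau\mapsto e^{-\tau^2/2}$, evaluated at $x$. $\Gamma$ is the Gamma function. A sum whose upper limit is smaller than its lower limit is empty, i.e. equal to $0$. *)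

theory Defs
  imports "HOL-Analysis.Analysis"
begin

text \<open>
  The operators are total functions. The accompanying \<open>_exists\<close> predicates say that the integrals
  involved converge absolutely and that the derivatives involved exist, so that the value is
  genuine and not a default one. All operators have lower terminal \<open>a\<close> and are meant for \<open>a < x\<close>.
\<close>

definition RL_integral :: "real \<Rightarrow> real \<Rightarrow> (real \<Rightarrow> real) \<Rightarrow> real \<Rightarrow> real" where
  "RL_integral \<alpha> a f x =
     1 / Gamma \<alpha> * integral {a..x} (\<lambda>\<tau>. (x - \<tau>) powr (\<alpha> - 1) * f \<tau>)"

definition RL_integral_exists :: "real \<Rightarrow> real \<Rightarrow> (real \<Rightarrow> real) \<Rightarrow> real \<Rightarrow> bool" where
  "RL_integral_exists \<alpha> a f x \<longleftrightarrow>
     (\<lambda>\<tau>. (x - \<tau>) powr (\<alpha> - 1) * f \<tau>) absolutely_integrable_on {a..x}"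

definition RL_derivative :: "real \<Rightarrow> real \<Rightarrow> (real \<Rightarrow> real) \<Rightarrow> real \<Rightarrow> real" where
  "RL_derivative \<alpha> a f x =
     (let m = nat \<lceil>\<alpha>\<rceil> in
       1 / Gamma (real m - \<alpha>) *
       (deriv ^^ m) (\<lambda>t. integral {a..t} (\<lambda>\<tau>. (t - \<tau>) powr (real m - \<alpha> - 1) * f \<tau>)) x)"

definition RL_derivative_exists :: "real \<Rightarrow> real \<Rightarrow> (real \<Rightarrow> real) \<Rightarrow> real \<Rightarrow> bool" where
  "RL_derivative_exists \<alpha> a f x \<longleftrightarrow>
     (let m = nat \<lceil>\<alpha>\<rceil> in
       \<forall>\<^sub>F t in nhds x.
         (\<lambda>\<tau>. (t - \<tau>) powr (real m - \<alpha> - 1) * f \<tau>) absolutely_integrable_on {a..t} \<and>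
         (\<forall>j<m. (deriv ^^ j)
            (\<lambda>s. integral {a..s} (\<lambda>\<tau>. (s - \<tau>) powr (real m - \<alpha> - 1) * f \<tau>))
              differentiable (at t)))"

definition Caputo_derivative :: "real \<Rightarrow> real \<Rightarrow> (real \<Rightarrow> real) \<Rightarrow> real \<Rightarrow> real" where
  "Caputo_derivative \<alpha> a f x =
     (let m = nat \<lceil>\<alpha>\<rceil> in
       1 / Gamma (real m - \<alpha>) *
       integral {a..x} (\<lambda>\<tau>. (x - \<tau>) powr (real m - \<alpha> - 1) * (deriv ^^ m) f \<tau>))"

definition Caputo_derivative_exists :: "real \<Rightarrow> real \<Rightarrow> (real \<Rightarrow> real) \<Rightarrow> real \<Rightarrow> bool" where
  "Caputo_derivative_exists \<alpha> a f x \<longleftrightarrow>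
     (let m = nat \<lceil>\<alpha>\<rceil> in
       (\<forall>j<m. \<forall>t\<in>{a..x}. (deriv ^^ j) f differentiable (at t)) \<and>
       (\<lambda>\<tau>. (x - \<tau>) powr (real m - \<alpha> - 1) * (deriv ^^ m) f \<tau>) absolutely_integrable_on {a..x})"

text \<open>
  The coefficients below are the \<open>n\<close>-th terms of the three series. In the Caputo case the inner sum
  runs over \<open>0 \<le> k \<le> 2n - m\<close> with integer subtraction; it is written \<open>k + m \<le> 2n\<close> because
  truncated subtraction would leave the spurious term \<open>k = 0\<close> when \<open>2n < m\<close>. For \<open>k\<close> in these
  ranges the remaining natural-number subtractions are exact.
\<close>

definition RL_integral_term :: "real \<Rightarrow> real \<Rightarrow> real \<Rightarrow> nat \<Rightarrow> real" where
  "RL_integral_term \<alpha> a x n =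
     (-1) ^ n * fact (2 * n) / (2 ^ n * fact n) *
     (\<Sum>k=0..2*n. a ^ (2 * n - k) * (x - a) ^ k / (fact (2 * n - k) * Gamma (\<alpha> + real k + 1)))"

definition RL_derivative_term :: "real \<Rightarrow> real \<Rightarrow> real \<Rightarrow> nat \<Rightarrow> real" where
  "RL_derivative_term \<alpha> a x n =
     (-1) ^ n * fact (2 * n) / (2 ^ n * fact n) *
     (\<Sum>k=0..2*n. a ^ (2 * n - k) * (x - a) ^ k / (fact (2 * n - k) * Gamma (real k - \<alpha> + 1)))"

definition Caputo_derivative_term :: "real \<Rightarrow> nat \<Rightarrow> real \<Rightarrow> real \<Rightarrow> nat \<Rightarrow> real" where
  "Caputo_derivative_term \<alpha> m a x n =
     (-1) ^ n * fact (2 * n) / (2 ^ n * fact n) *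
     (\<Sum>k | k + m \<le> 2 * n.
        a ^ (2 * n - k) * (x - a) ^ k / (fact (2 * n - m - k) * Gamma (real m - \<alpha> + real k + 1)))"

end

theory Submission
  imports Defs
begin

text \<open>
  The Gaussian is an entire power series $\sum_i c_i \tau^i$ with $c_i = 0$ for odd $i$, and all three
  operators may be applied to it term by term. On a single power, the binomial expansion of
  $\tau^j = ((\tau - a) + a)^j$ and the Beta integral give
  $${}_aI_t^{\beta}\,\tau^j = \sum_{k \le j} \frac{j!}{(j-k)!}\, a^{j-k}\,
    \frac{(t-a)^{\beta+k}}{\Gamma(\beta+k+1)} =: P^{\beta}_j(t),$$
  and the three series are $\sum_i c_i P^{\beta}_i(x)$ up to powers of $x - a$ and of $a$.

  The right-hand side $P^{\beta}_j$ makes sense for every real $\beta$ once $1/\Gamma$ is read as the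
  entire reciprocal Gamma function, and then $\Gamma(z+1) = z\,\Gamma(z)$ says that
  $(P^{\beta}_j)' = P^{\beta-1}_j$ (\<open>RL_monomial_has_derivative\<close>). Thus integrals and derivatives
  of fractional order are values of one family: with $\beta = m - \alpha > 0$ the derivative of order
  $\alpha$ is the $m$-th classical derivative of $\sum_i c_i P^{m-\alpha}_i$, which is
  $\sum_i c_i P^{-\alpha}_i$.

  Two interchanges of limits need justification. Summation and integration commute by dominated
  convergence, as the partial sums of the power series are bounded on the compact interval and the
  kernel is integrable (\<open>RL_integral_power_series\<close>). Summation and differentiation commute because
  $|P^{\beta}_j(t)| \le C\,(t-a)^{\beta}\,(|a| + 2(t-a))^j$ with $C$ depending on $\beta$ and $a$ only
  (\<open>RL_monomial_bound\<close>), so the differentiated series is dominated by the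
  absolutely convergent power series at a fixed point (\<open>RL_series_has_derivative\<close>).

  The Caputo derivative is the fractional integral of order $m - \alpha$ of the $m$-th derivative of the
  Gaussian, again an entire power series, whose coefficients are the iterated \<open>diffs\<close> of the $c_i$.
  Its index $j$ corresponds to $i = j + m$ in the original series; this explains both the upper limit
  $2n - m$ of the inner sum and the factor $a^m$ that turns $a^{j-k}$ into $a^{2n-k}$.
\<close>

section \<open>Fractional integrals of powers\<close>

lemma has_integral_Riemann_Liouville_power:
  fixes \<beta> \<gamma> a t :: real
  assumes "\<beta> > 0" "\<gamma> > 0" "a < t"
  shows "((\<lambda>\<tau>. (t - \<tau>) powr (\<beta> - 1) * (\<tau> - a) powr (\<gamma> - 1)) has_integral
           (t - a) powr (\<beta> + \<gamma> - 1) * Beta \<gamma> \<beta>) {a..t}"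
proof -
  define L where "L = t - a"
  have L: "L > 0" using assms by (simp add: L_def)
  have "((\<lambda>s. s powr (\<gamma> - 1) * (1 - s) powr (\<beta> - 1)) has_integral Beta \<gamma> \<beta>) (cbox 0 1)"
    using has_integral_Beta_real[of \<gamma> \<beta>] assms by simp
  from has_integral_affinity'[OF this, of "1/L" "-a/L"] L
  have affine: "((\<lambda>\<tau>. ((1/L) *\<^sub>R \<tau> + -a/L) powr (\<gamma> - 1) * (1 - ((1/L) *\<^sub>R \<tau> + -a/L)) powr (\<beta> - 1))
        has_integral Beta \<gamma> \<beta> /\<^sub>R (1/L) ^ DIM(real)) (cbox ((0 - -a/L) /\<^sub>R (1/L)) ((1 - -a/L) /\<^sub>R (1/L)))"
    by simp
  have bounds: "(0 - -a/L) /\<^sub>R (1/L) = a" "(1 - -a/L) /\<^sub>R (1/L) = t"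
    using L by (simp_all add: field_simps L_def)
  have "((\<lambda>\<tau>. (1/L * \<tau> + -a/L) powr (\<gamma> - 1) * (1 - (1/L * \<tau> + -a/L)) powr (\<beta> - 1))
          has_integral Beta \<gamma> \<beta> * L) {a..t}"
    using affine[unfolded bounds] L by (simp add: mult.commute)
  from has_integral_mult_right[OF this, of "L powr (\<beta> + \<gamma> - 2)"]
  have "((\<lambda>\<tau>. L powr (\<beta> + \<gamma> - 2) * ((1/L * \<tau> + -a/L) powr (\<gamma> - 1) *
            (1 - (1/L * \<tau> + -a/L)) powr (\<beta> - 1)))
          has_integral L powr (\<beta> + \<gamma> - 2) * (Beta \<gamma> \<beta> * L)) {a..t}" .
  moreover have "L powr (\<beta> + \<gamma> - 2) * (Beta \<gamma> \<beta> * L) = L powr (\<beta> + \<gamma> - 1) * Beta \<gamma> \<beta>"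
    using L powr_mult_base[of L "\<beta> + \<gamma> - 2"] by (simp add: algebra_simps)
  moreover have "L powr (\<beta> + \<gamma> - 2) * ((1/L * \<tau> + -a/L) powr (\<gamma> - 1) *
            (1 - (1/L * \<tau> + -a/L)) powr (\<beta> - 1)) =
          (t - \<tau>) powr (\<beta> - 1) * (\<tau> - a) powr (\<gamma> - 1)" if "\<tau> \<in> {a..t}" for \<tau>
  proof -
    have 1: "1/L * \<tau> + -a/L = (\<tau> - a) / L" by (simp add: diff_divide_distrib)
    have 2: "1 - (\<tau> - a) / L = (t - \<tau>) / L" using L by (simp add: L_def field_simps)
    have 3: "L powr (\<beta> + \<gamma> - 2) = L powr (\<beta> - 1) * L powr (\<gamma> - 1)"
      by (simp add: powr_add[symmetric])
    show ?thesis unfolding 1 2 3 using L that by (simp add: powr_divide)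
  qed
  ultimately show ?thesis
    unfolding L_def by (metis (no_types, lifting) has_integral_cong)
qed

lemma Beta_of_nat_Suc:
  fixes \<beta> :: real
  shows "Beta (real k + 1) \<beta> = Gamma \<beta> * (fact k * rGamma (\<beta> + real k + 1))"
  using Gamma_fact[of k, where 'a = real] by (simp add: Beta_altdef add_ac)

text \<open>
  The differintegral of order $-\beta$ of $\tau^j$ with lower terminal $a$: the fractional integral of
  order $\beta$ when $\beta > 0$. Using \<open>rGamma\<close>, which vanishes at the poles of the Gamma function,
  extends the formula to all real $\beta$ and makes the family closed under differentiation.
\<close>

definition RL_monomial :: "real \<Rightarrow> real \<Rightarrow> nat \<Rightarrow> real \<Rightarrow> real" where
  "RL_monomial \<beta> a j t =
     (\<Sum>k\<le>j. fact j / fact (j - k) * a ^ (j - k) *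
              (rGamma (\<beta> + real k + 1) * (t - a) powr (\<beta> + real k)))"

lemma has_integral_RL_monomial:
  assumes "\<beta> > 0" "a < t"
  shows "((\<lambda>\<tau>. (t - \<tau>) powr (\<beta> - 1) * \<tau> ^ j) has_integral Gamma \<beta> * RL_monomial \<beta> a j t) {a..t}"
proof -
  have shifted: "((\<lambda>\<tau>. (t - \<tau>) powr (\<beta> - 1) * (\<tau> - a) ^ k) has_integral
      (t - a) powr (\<beta> + real k) * Beta (real k + 1) \<beta>) {a..t}" for k
  proof -
    have "((\<lambda>\<tau>. (t - \<tau>) powr (\<beta> - 1) * (\<tau> - a) powr (real k + 1 - 1)) has_integral
      (t - a) powr (\<beta> + (real k + 1) - 1) * Beta (real k + 1) \<beta>) {a..t}"
      using assms by (intro has_integral_Riemann_Liouville_power) auto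
    then have *: "((\<lambda>\<tau>. (t - \<tau>) powr (\<beta> - 1) * (\<tau> - a) powr real k) has_integral
      (t - a) powr (\<beta> + real k) * Beta (real k + 1) \<beta>) {a..t}"
      by (simp add: add_ac)
    \<comment> \<open>at \<open>\<tau> = a\<close> and \<open>k = 0\<close> the two powers differ, since \<open>0 powr 0 = 0\<close>\<close>
    show ?thesis
      by (rule has_integral_spike_finite[OF _ _ *, of "{a}"]) (auto simp: powr_realpow)
  qed
  \<comment> \<open>binomial expansion of \<open>\<tau> ^ j = ((\<tau> - a) + a) ^ j\<close>\<close>
  have "((\<lambda>\<tau>. \<Sum>k\<le>j. (real (j choose k) * a ^ (j - k)) * ((t - \<tau>) powr (\<beta> - 1) * (\<tau> - a) ^ k))
          has_integral (\<Sum>k\<le>j. (real (j choose k) * a ^ (j - k)) *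
            ((t - a) powr (\<beta> + real k) * Beta (real k + 1) \<beta>))) {a..t}"
    by (intro has_integral_sum has_integral_mult_right shifted) auto
  moreover have "(\<Sum>k\<le>j. (real (j choose k) * a ^ (j - k)) * ((t - \<tau>) powr (\<beta> - 1) * (\<tau> - a) ^ k))
      = (t - \<tau>) powr (\<beta> - 1) * \<tau> ^ j" for \<tau>
    using binomial_ring[of "\<tau> - a" a j] by (simp add: sum_distrib_left mult_ac)
  moreover have "(\<Sum>k\<le>j. (real (j choose k) * a ^ (j - k)) *
            ((t - a) powr (\<beta> + real k) * Beta (real k + 1) \<beta>)) = Gamma \<beta> * RL_monomial \<beta> a j t"
    unfolding RL_monomial_def sum_distrib_left
    by (intro sum.cong refl) (simp add: Beta_of_nat_Suc binomial_fact)
  ultimately show ?thesis by simp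
qed

text \<open>
  Differentiating $(t-a)^{\beta+k}/\Gamma(\beta+k+1)$ produces the factor $\beta + k$, which the
  functional equation of the reciprocal Gamma function absorbs. That
  equation, \<open>rGamma_plus1\<close>, holds at the poles of the Gamma function too, so integer orders need no
  separate treatment.
\<close>

lemma RL_monomial_has_derivative:
  assumes "a < t"
  shows "(RL_monomial \<beta> a j has_real_derivative RL_monomial (\<beta> - 1) a j t) (at t)"
proof -
  have rGamma_shift: "rGamma (\<beta> + real k + 1) * (\<beta> + real k) = rGamma (\<beta> + real k)" for k
    using rGamma_plus1[of "\<beta> + real k"] by (simp add: mult.commute)
  have "((\<lambda>t. rGamma (\<beta> + real k + 1) * (t - a) powr (\<beta> + real k)) has_real_derivative
         rGamma (\<beta> - 1 + real k + 1) * (t - a) powr (\<beta> - 1 + real k)) (at t)" for k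
    using assms
    by (auto intro!: derivative_eq_intros simp: rGamma_shift[symmetric] algebra_simps)
  then show ?thesis
    unfolding RL_monomial_def [abs_def]
    by (intro DERIV_sum DERIV_cmult)
qed

section \<open>Termwise differentiation\<close>

text \<open>
  The ratio of consecutive values of $k!/\Gamma(\beta+k+1)$ is $(k+1)/(\beta+k+1) \to 1$, so the growth is
  subexponential; any base above $1$ would serve, and $2$ keeps the later estimate explicit.
\<close>

lemma fact_rGamma_bound:
  fixes \<beta> :: real
  obtains C where "C > 0" "\<And>k. fact k * \<bar>rGamma (\<beta> + real k + 1)\<bar> \<le> C * 2 ^ k"
proof -
  define r where "r k = fact k * rGamma (\<beta> + real k + 1) / 2 ^ k" for k
  have "summable r"
  proof (rule summable_ratio_test)
    show "3/4 < (1::real)" by simp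
    \<comment> \<open>from this index on the ratio \<open>(k + 1) / (\<beta> + k + 1)\<close> is at most \<open>3/2\<close>, and the division
      by \<open>2 ^ k\<close> halves it\<close>
    fix k assume k: "k \<ge> nat \<lceil>3 * \<bar>\<beta>\<bar> + 3\<rceil>"
    define z where "z = \<beta> + real k + 1"
    have kb: "real k \<ge> 3 * \<bar>\<beta>\<bar> + 3" using k by linarith
    have z: "z > 0" "real k + 1 \<le> 3/2 * z" using kb by (auto simp: z_def)
    have "rGamma (z + 1) = rGamma z / z" using rGamma_plus1[of z] z by (simp add: field_simps)
    then have "r (Suc k) = r k * ((real k + 1) / (2 * z))"
      by (simp add: r_def z_def field_simps)
    moreover have "(real k + 1) / (2 * z) \<le> 3/4" using z by (simp add: field_simps)
    ultimately show "norm (r (Suc k)) \<le> 3/4 * norm (r k)"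
      using z mult_left_mono[of "(real k + 1) / (2 * z)" "3/4" "\<bar>r k\<bar>"]
      by (simp add: abs_mult)
  qed
  then have "Bseq r" by (rule summable_imp_Bseq)
  then obtain C where C: "C > 0" "\<And>k. norm (r k) \<le> C" by (auto simp: Bseq_def)
  show ?thesis
  proof (rule that[OF C(1)])
    fix k show "fact k * \<bar>rGamma (\<beta> + real k + 1)\<bar> \<le> C * 2 ^ k"
      using C(2)[of k] by (simp add: r_def abs_mult field_simps)
  qed
qed

text \<open>
  Exponential growth in $j$, uniformly in $t$ up to the factor $(t-a)^{\beta}$: writing
  $j!/(j-k)! = \binom{j}{k}\, k!$, the previous bound replaces $k!/\Gamma(\beta+k+1)$ by $C\,2^k$, and what
  remains is the binomial expansion of $(|a| + 2(t-a))^j$. Against entire coefficients this is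
  summable whatever the size of the base.
\<close>

lemma RL_monomial_bound:
  fixes \<beta> a :: real
  obtains C where "C > 0"
    "\<And>j t. a < t \<Longrightarrow> \<bar>RL_monomial \<beta> a j t\<bar> \<le> C * (t - a) powr \<beta> * (\<bar>a\<bar> + 2 * (t - a)) ^ j"
proof -
  obtain C where C: "C > 0" "\<And>k. fact k * \<bar>rGamma (\<beta> + real k + 1)\<bar> \<le> C * 2 ^ k"
    using fact_rGamma_bound[of \<beta>] by blast
  have "\<bar>RL_monomial \<beta> a j t\<bar> \<le> C * (t - a) powr \<beta> * (\<bar>a\<bar> + 2 * (t - a)) ^ j" if t: "a < t" for j t
  proof -
    have "\<bar>RL_monomial \<beta> a j t\<bar> \<le> (\<Sum>k\<le>j. \<bar>fact j / fact (j - k) * a ^ (j - k) *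
              (rGamma (\<beta> + real k + 1) * (t - a) powr (\<beta> + real k))\<bar>)"
      unfolding RL_monomial_def by (rule sum_abs)
    also have "\<dots> = (\<Sum>k\<le>j. (fact k * \<bar>rGamma (\<beta> + real k + 1)\<bar>) *
        (real (j choose k) * \<bar>a\<bar> ^ (j - k) * ((t - a) powr \<beta> * (t - a) ^ k)))"
      using t by (intro sum.cong refl)
        (simp add: abs_mult binomial_fact powr_add powr_realpow power_abs)
    also have "\<dots> \<le> (\<Sum>k\<le>j. (C * 2 ^ k) *
        (real (j choose k) * \<bar>a\<bar> ^ (j - k) * ((t - a) powr \<beta> * (t - a) ^ k)))"
      using t by (intro sum_mono mult_right_mono C) auto
    also have "\<dots> = C * (t - a) powr \<beta> * (2 * (t - a) + \<bar>a\<bar>) ^ j"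
      unfolding binomial_ring sum_distrib_left
      by (intro sum.cong refl) (simp only: power_mult_distrib mult_ac)
    finally show ?thesis by (simp add: add.commute)
  qed
  with C(1) that show ?thesis by blast
qed

lemma everywhere_summable_imp_abs_summable:
  fixes c :: "nat \<Rightarrow> real"
  assumes "\<And>x. summable (\<lambda>n. c n * x ^ n)"
  shows "summable (\<lambda>n. \<bar>c n\<bar> * \<bar>x\<bar> ^ n)"
  using powser_insidea[OF assms[of "\<bar>x\<bar> + 1"], of x] by (simp add: abs_mult power_abs)

lemma RL_series_summable:
  fixes c :: "nat \<Rightarrow> real"
  assumes c: "\<And>x. summable (\<lambda>n. c n * x ^ n)" and t: "a < t"
  shows "summable (\<lambda>j. c j * RL_monomial \<beta> a j t)"
proof -
  obtain C where C: "C > 0"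
    "\<And>j t. a < t \<Longrightarrow> \<bar>RL_monomial \<beta> a j t\<bar> \<le> C * (t - a) powr \<beta> * (\<bar>a\<bar> + 2 * (t - a)) ^ j"
    using RL_monomial_bound[of a \<beta>] by blast
  define R where "R = \<bar>a\<bar> + 2 * (t - a)"
  have "R \<ge> 0" using t by (simp add: R_def)
  have *: "summable (\<lambda>j. C * (t - a) powr \<beta> * (\<bar>c j\<bar> * R ^ j))"
    using everywhere_summable_imp_abs_summable[OF c, of R] \<open>R \<ge> 0\<close> by (intro summable_mult) simp
  show ?thesis
  proof (rule summable_comparison_test'[OF *])
    fix j show "norm (c j * RL_monomial \<beta> a j t) \<le> C * (t - a) powr \<beta> * (\<bar>c j\<bar> * R ^ j)"
      using mult_left_mono[OF C(2)[OF t, of j], of "\<bar>c j\<bar>"] by (simp add: abs_mult R_def mult_ac)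
  qed
qed

text \<open>
  On a compact neighbourhood of $t$ inside $(a, \infty)$ the factor $(s-a)^{\beta-1}$ is bounded, so the
  differentiated series converges uniformly there by the Weierstrass test. The neighbourhood has to
  stay away from $a$, where this factor may blow up.
\<close>

lemma RL_series_has_derivative:
  fixes c :: "nat \<Rightarrow> real"
  assumes c: "\<And>x. summable (\<lambda>n. c n * x ^ n)" and t: "a < t"
  shows "((\<lambda>t. \<Sum>j. c j * RL_monomial \<beta> a j t) has_real_derivative
          (\<Sum>j. c j * RL_monomial (\<beta> - 1) a j t)) (at t)"
proof -
  define S where "S = {(a + t) / 2..t + 1}"
  have S: "a < s" "s \<le> t + 1" if "s \<in> S" for s using that t by (auto simp: S_def)
  obtain C where C: "C > 0" "\<And>j t. a < t \<Longrightarrow>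
      \<bar>RL_monomial (\<beta> - 1) a j t\<bar> \<le> C * (t - a) powr (\<beta> - 1) * (\<bar>a\<bar> + 2 * (t - a)) ^ j"
    using RL_monomial_bound[of a "\<beta> - 1"] by blast
  define R where "R = \<bar>a\<bar> + 2 * (t + 1 - a)"
  have "R \<ge> 0" using t by (simp add: R_def)
  have "compact ((\<lambda>s. (s - a) powr (\<beta> - 1)) ` S)"
    using S by (intro compact_continuous_image continuous_intros) (force simp: S_def)+
  then obtain B where B: "\<And>s. s \<in> S \<Longrightarrow> norm ((s - a) powr (\<beta> - 1)) \<le> B"
    by (meson bounded_iff compact_imp_bounded imageI)
  have t': "t \<in> interior S" using t by (simp add: S_def)
  show ?thesis
  proof (rule has_field_derivative_series'(2)[of S])
    show "convex S" by (simp add: S_def)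
    show "((\<lambda>t. c n * RL_monomial \<beta> a n t) has_field_derivative c n * RL_monomial (\<beta> - 1) a n s)
            (at s within S)" if "s \<in> S" for n s
      by (rule has_field_derivative_at_within)
         (rule DERIV_cmult[OF RL_monomial_has_derivative[OF S(1)[OF that]]])
    show "uniformly_convergent_on S (\<lambda>n s. \<Sum>i<n. c i * RL_monomial (\<beta> - 1) a i s)"
    proof (rule Weierstrass_m_test')
      show "summable (\<lambda>j. C * B * (\<bar>c j\<bar> * R ^ j))"
        using everywhere_summable_imp_abs_summable[OF c, of R] \<open>R \<ge> 0\<close>
        by (intro summable_mult) simp
      fix j s assume s: "s \<in> S"
      have "\<bar>RL_monomial (\<beta> - 1) a j s\<bar> \<le> C * (s - a) powr (\<beta> - 1) * (\<bar>a\<bar> + 2 * (s - a)) ^ j"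
        using C(2) S(1)[OF s] .
      also have "\<dots> \<le> C * B * R ^ j"
        using S[OF s] B[OF s] order_trans[OF norm_ge_zero B[OF s]] C(1)
        by (intro mult_mono power_mono) (auto simp: R_def)
      finally show "norm (c j * RL_monomial (\<beta> - 1) a j s) \<le> C * B * (\<bar>c j\<bar> * R ^ j)"
        using mult_left_mono[of "\<bar>RL_monomial (\<beta> - 1) a j s\<bar>" "C * B * R ^ j" "\<bar>c j\<bar>"]
        by (simp add: abs_mult mult_ac)
    qed
    show "t \<in> S" using t' interior_subset by blast
    show "summable (\<lambda>n. c n * RL_monomial \<beta> a n t)" using RL_series_summable[OF c t] .
  qed (use t' in simp)
qed

section \<open>Fractional integrals of entire power series\<close>

text \<open>
  The kernel times $\sum_n |c_n|\,(|a|+|t|)^n$ is an integrable majorant of all partial sums. The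
  same majorant bounds the limit, which yields absolute integrability.
\<close>

lemma RL_integral_power_series:
  fixes c :: "nat \<Rightarrow> real"
  assumes c: "\<And>x. summable (\<lambda>n. c n * x ^ n)" and \<beta>: "\<beta> > 0" and t: "a < t"
  shows "(\<lambda>\<tau>. (t - \<tau>) powr (\<beta> - 1) * (\<Sum>n. c n * \<tau> ^ n)) absolutely_integrable_on {a..t}" (is ?A)
    and "integral {a..t} (\<lambda>\<tau>. (t - \<tau>) powr (\<beta> - 1) * (\<Sum>n. c n * \<tau> ^ n)) =
           Gamma \<beta> * (\<Sum>j. c j * RL_monomial \<beta> a j t)" (is "integral _ ?f = _")
proof -
  define R where "R = \<bar>a\<bar> + \<bar>t\<bar>"
  define M where "M = (\<Sum>n. \<bar>c n\<bar> * R ^ n)"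
  define p where "p N \<tau> = (t - \<tau>) powr (\<beta> - 1) * (\<Sum>n<N. c n * \<tau> ^ n)" for N \<tau>
  define h where "h \<tau> = (t - \<tau>) powr (\<beta> - 1) * M" for \<tau>
  have R: "summable (\<lambda>n. \<bar>c n\<bar> * R ^ n)"
    using everywhere_summable_imp_abs_summable[OF c, of R] by (simp add: R_def)
  have partial_sum_bound: "\<bar>\<Sum>n<N. c n * \<tau> ^ n\<bar> \<le> M" if "\<tau> \<in> {a..t}" for N \<tau>
  proof -
    have "\<bar>\<Sum>n<N. c n * \<tau> ^ n\<bar> \<le> (\<Sum>n<N. \<bar>c n * \<tau> ^ n\<bar>)" by (rule sum_abs)
    also have "\<dots> \<le> (\<Sum>n<N. \<bar>c n\<bar> * R ^ n)"
      using that by (intro sum_mono) (auto simp: abs_mult power_abs R_def intro!: mult_left_mono power_mono)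
    also have "\<dots> \<le> M" unfolding M_def
      by (rule sum_le_suminf[OF R]) (auto simp: R_def)
    finally show ?thesis .
  qed
  have p_integral: "(p N has_integral (\<Sum>n<N. c n * (Gamma \<beta> * RL_monomial \<beta> a n t))) {a..t}" for N
  proof -
    have "((\<lambda>\<tau>. \<Sum>n<N. c n * ((t - \<tau>) powr (\<beta> - 1) * \<tau> ^ n)) has_integral
            (\<Sum>n<N. c n * (Gamma \<beta> * RL_monomial \<beta> a n t))) {a..t}"
      by (intro has_integral_sum has_integral_mult_right has_integral_RL_monomial \<beta> t) auto
    then show ?thesis by (simp add: p_def [abs_def] sum_distrib_left mult_ac)
  qed
  have h: "h integrable_on {a..t}"
    using has_integral_mult_left[OF has_integral_RL_monomial[OF \<beta> t, of 0], of M]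
    by (auto simp: h_def [abs_def] integrable_on_def)
  have p_le: "norm (p N \<tau>) \<le> h \<tau>" if "\<tau> \<in> {a..t}" for N \<tau>
    using partial_sum_bound[OF that, of N] by (simp add: p_def h_def abs_mult mult_left_mono)
  have p_lim: "(\<lambda>N. p N \<tau>) \<longlonglongrightarrow> ?f \<tau>" for \<tau>
    unfolding p_def by (intro tendsto_mult tendsto_const summable_LIMSEQ c)
  have f_le: "norm (?f \<tau>) \<le> h \<tau>" if "\<tau> \<in> {a..t}" for \<tau>
    by (rule LIMSEQ_le_const2[OF tendsto_norm[OF p_lim]]) (use p_le that in blast)
  have p_int: "p N integrable_on {a..t}" for N using p_integral by blast
  note dct = dominated_convergence[OF p_int h p_le p_lim]
  show ?A by (rule absolutely_integrable_integrable_bound[OF f_le dct(1) h])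
  have "(\<lambda>N. integral {a..t} (p N)) = (\<lambda>N. \<Sum>n<N. Gamma \<beta> * (c n * RL_monomial \<beta> a n t))"
    using integral_unique[OF p_integral] by (simp add: mult_ac)
  with dct(2) have "(\<lambda>n. Gamma \<beta> * (c n * RL_monomial \<beta> a n t)) sums integral {a..t} ?f"
    by (simp add: sums_def)
  moreover have "(\<lambda>n. Gamma \<beta> * (c n * RL_monomial \<beta> a n t)) sums
                   (Gamma \<beta> * (\<Sum>j. c j * RL_monomial \<beta> a j t))"
    by (intro sums_mult summable_sums RL_series_summable c t)
  ultimately show "integral {a..t} ?f = Gamma \<beta> * (\<Sum>j. c j * RL_monomial \<beta> a j t)"
    by (rule sums_unique2)
qed

text \<open>
  Each classical derivative lowers $\beta$ by one. The formula holds on the open half-line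
  $(a, \infty)$ only, which suffices because differentiation is local.
\<close>

lemma RL_integral_iterated_deriv:
  fixes c :: "nat \<Rightarrow> real" and \<beta> a :: real
  assumes c: "\<And>x. summable (\<lambda>n. c n * x ^ n)" and \<beta>: "\<beta> > 0"
  defines "G \<equiv> \<lambda>s. integral {a..s} (\<lambda>\<tau>. (s - \<tau>) powr (\<beta> - 1) * (\<Sum>n. c n * \<tau> ^ n))"
  assumes t: "a < t"
  shows "(deriv ^^ j) G t = Gamma \<beta> * (\<Sum>i. c i * RL_monomial (\<beta> - real j) a i t)" (is ?A)
    and "(deriv ^^ j) G differentiable (at t)" (is ?B)
proof -
  have step: "(g has_real_derivative Gamma \<beta> * (\<Sum>i. c i * RL_monomial (\<beta> - real (Suc j)) a i s)) (at s)"
    if g: "\<And>t. a < t \<Longrightarrow> g t = Gamma \<beta> * (\<Sum>i. c i * RL_monomial (\<beta> - real j) a i t)" and s: "a < s"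
    for g j s
  proof (rule has_field_derivative_transform_within_open[where S = "{a<..}"])
    show "((\<lambda>t. Gamma \<beta> * (\<Sum>i. c i * RL_monomial (\<beta> - real j) a i t)) has_real_derivative
           Gamma \<beta> * (\<Sum>i. c i * RL_monomial (\<beta> - real (Suc j)) a i s)) (at s)"
      using DERIV_cmult[OF RL_series_has_derivative[OF c s, where \<beta> = "\<beta> - real j"]]
      by (simp add: algebra_simps)
  qed (use g s in auto)
  have iterated: "a < s \<Longrightarrow> (deriv ^^ j) G s = Gamma \<beta> * (\<Sum>i. c i * RL_monomial (\<beta> - real j) a i s)" for s j
  proof (induction j arbitrary: s)
    case 0
    then show ?case unfolding G_def using RL_integral_power_series(2)[OF c \<beta>] by simp
  next
    case (Suc j)
    then show ?case using DERIV_imp_deriv[OF step[OF Suc.IH]] by simp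
  qed
  show ?A using iterated[OF t] .
  show ?B using step[OF iterated t] real_differentiable_def by blast
qed

section \<open>Iterated derivatives of entire power series\<close>

lemma summable_diffs_funpow:
  fixes c :: "nat \<Rightarrow> real"
  assumes "\<And>x. summable (\<lambda>n. c n * x ^ n)"
  shows "summable (\<lambda>n. (diffs ^^ j) c n * x ^ n)"
  using assms by (induction j arbitrary: x) (auto intro: termdiff_converges_all)

lemma diffs_funpow_eq:
  fixes c :: "nat \<Rightarrow> real"
  shows "(diffs ^^ j) c n = fact (n + j) / fact n * c (n + j)"
proof (induction j arbitrary: n)
  case (Suc j)
  have "(diffs ^^ Suc j) c n = real (Suc n) * (diffs ^^ j) c (Suc n)" by (simp add: diffs_def)
  also have "\<dots> = (real (Suc n) / fact (Suc n)) * (fact (Suc n + j) * c (Suc n + j))"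
    unfolding Suc.IH by simp
  also have "real (Suc n) / fact (Suc n) = 1 / fact n" by (simp del: of_nat_Suc)
  finally show ?case by simp
qed simp

lemma power_series_iterated_deriv:
  fixes c :: "nat \<Rightarrow> real"
  assumes c: "\<And>x. summable (\<lambda>n. c n * x ^ n)"
  defines "g \<equiv> \<lambda>x. \<Sum>n. c n * x ^ n"
  shows "(deriv ^^ j) g = (\<lambda>x. \<Sum>n. (diffs ^^ j) c n * x ^ n)"
    and "(deriv ^^ j) g differentiable (at x)"
proof -
  have step: "((\<lambda>x. \<Sum>n. (diffs ^^ j) c n * x ^ n) has_real_derivative
                (\<Sum>n. (diffs ^^ Suc j) c n * x ^ n)) (at x)" for j x
    using termdiffs_strong_converges_everywhere[OF summable_diffs_funpow[OF c, of j]] by simp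
  show *: "(deriv ^^ j) g = (\<lambda>x. \<Sum>n. (diffs ^^ j) c n * x ^ n)" for j
  proof (induction j)
    case 0 then show ?case by (simp add: g_def)
  next
    case (Suc j)
    then show ?case using DERIV_imp_deriv[OF step[of j]] by auto
  qed
  show "(deriv ^^ j) g differentiable (at x)"
    unfolding * using step real_differentiable_def by blast
qed

section \<open>The Gaussian\<close>

definition gauss_coeff :: "nat \<Rightarrow> real" where
  "gauss_coeff i = (if even i then (-1) ^ (i div 2) / (2 ^ (i div 2) * fact (i div 2)) else 0)"

lemma strict_mono_double: "strict_mono (\<lambda>n::nat. 2 * n)"
  by (simp add: strict_mono_def)

lemma gauss_coeff_double: "gauss_coeff (2 * n) = (-1) ^ n / (2 ^ n * fact n)"
  by (simp add: gauss_coeff_def)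

lemma gauss_coeff_eq_0: "i \<notin> range (\<lambda>n. 2 * n) \<Longrightarrow> gauss_coeff i = 0"
  by (auto simp: gauss_coeff_def elim!: evenE)

lemma gauss_coeff_sums: "(\<lambda>i. gauss_coeff i * x ^ i) sums exp (- (x\<^sup>2 / 2))"
proof -
  have "(\<lambda>n. (- (x\<^sup>2 / 2)) ^ n /\<^sub>R fact n) sums exp (- (x\<^sup>2 / 2))" by (rule exp_converges)
  moreover have "(- (x\<^sup>2 / 2)) ^ n /\<^sub>R fact n = gauss_coeff (2 * n) * x ^ (2 * n)" for n
    unfolding gauss_coeff_double power_mult power_minus[of "x\<^sup>2 / 2"] power_divide
    by (simp add: divide_inverse mult_ac)
  ultimately have "(\<lambda>n. gauss_coeff (2 * n) * x ^ (2 * n)) sums exp (- (x\<^sup>2 / 2))" by simp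
  then show ?thesis
    by (subst (asm) sums_mono_reindex[OF strict_mono_double]) (auto simp: gauss_coeff_eq_0)
qed

lemma RL_monomial_factored:
  assumes "a < t"
  shows "RL_monomial \<beta> a j t = (t - a) powr \<beta> *
    (\<Sum>k\<le>j. fact j / fact (j - k) * a ^ (j - k) * (rGamma (\<beta> + real k + 1) * (t - a) ^ k))"
  unfolding RL_monomial_def sum_distrib_left
  using assms by (intro sum.cong refl) (simp add: powr_add powr_realpow mult_ac)

text \<open>
  Stated for every real $\beta$, since the terms of the derivative series are those of the integral
  series at $\beta = -\alpha$ (\<open>RL_derivative_term_eq\<close>).
\<close>

lemma RL_integral_term_eq:
  assumes "a < x"
  shows "(x - a) powr \<beta> * RL_integral_term \<beta> a x n = gauss_coeff (2 * n) * RL_monomial \<beta> a (2 * n) x"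
  unfolding RL_monomial_factored[OF assms] gauss_coeff_double RL_integral_term_def sum_distrib_left
    atLeast0AtMost
  by (intro sum.cong refl) (simp add: rGamma_inverse_Gamma field_simps)

lemma RL_integral_term_sums:
  assumes "a < x"
  shows "(\<lambda>n. (x - a) powr \<beta> * RL_integral_term \<beta> a x n) sums (\<Sum>i. gauss_coeff i * RL_monomial \<beta> a i x)"
  unfolding RL_integral_term_eq[OF assms]
  by (subst sums_mono_reindex[OF strict_mono_double])
     (auto simp: gauss_coeff_eq_0
       intro!: summable_sums RL_series_summable assms sums_summable[OF gauss_coeff_sums])

lemma RL_derivative_term_eq: "RL_derivative_term \<alpha> = RL_integral_term (- \<alpha>)"
  by (simp add: fun_eq_iff RL_derivative_term_def RL_integral_term_def add_ac)

lemma Caputo_term_eq: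
  assumes "a < x" "m \<le> 2 * n"
  shows "Caputo_derivative_term \<alpha> m a x n =
    a ^ m * (x - a) powr (\<alpha> - real m) *
      ((diffs ^^ m) gauss_coeff (2 * n - m) * RL_monomial (real m - \<alpha>) a (2 * n - m) x)"
proof -
  define j where "j = 2 * n - m"
  have j: "2 * n = j + m" using assms by (simp add: j_def)
  have range: "{k. k + m \<le> 2 * n} = {..j}" unfolding j by auto
  have cancel: "(x - a) powr (\<alpha> - real m) * (x - a) powr (real m - \<alpha>) = 1"
    using assms by (simp add: powr_add[symmetric])
  have split: "2 * n - m - k = j - k" "a ^ (2 * n - k) = a ^ m * a ^ (j - k)" if "k \<le> j" for k
    using that by (simp_all add: j power_add[symmetric] add.commute)
  have "a ^ m * (x - a) powr (\<alpha> - real m) *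
      ((diffs ^^ m) gauss_coeff j * RL_monomial (real m - \<alpha>) a j x) =
      ((x - a) powr (\<alpha> - real m) * (x - a) powr (real m - \<alpha>)) *
      (a ^ m * (fact (2 * n) / fact j * gauss_coeff (2 * n) *
      (\<Sum>k\<le>j. fact j / fact (j - k) * a ^ (j - k) *
        (rGamma (real m - \<alpha> + real k + 1) * (x - a) ^ k))))"
    unfolding RL_monomial_factored[OF assms(1)] diffs_funpow_eq j by (simp only: mult_ac)
  also have "\<dots> = Caputo_derivative_term \<alpha> m a x n"
    unfolding cancel gauss_coeff_double Caputo_derivative_term_def range sum_distrib_left
  proof (intro sum.cong refl)
    fix k assume "k \<in> {..j}"
    then have k: "k \<le> j" by simp
    show "1 * (a ^ m * (fact (2 * n) / fact j * ((- 1) ^ n / (2 ^ n * fact n)) *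
            (fact j / fact (j - k) * a ^ (j - k) * (rGamma (real m - \<alpha> + real k + 1) * (x - a) ^ k)))) =
          (- 1) ^ n * fact (2 * n) / (2 ^ n * fact n) * (a ^ (2 * n - k) * (x - a) ^ k /
            (fact (2 * n - m - k) * Gamma (real m - \<alpha> + real k + 1)))"
      unfolding split[OF k] rGamma_inverse_Gamma by (simp add: divide_inverse)
  qed
  finally show ?thesis by (simp add: j_def)
qed

text \<open>
  The series over the derivative's coefficients is shifted by $m$ with zeros in front, so that it is
  indexed like the series of the Gaussian; its odd terms then vanish. The terms with
  $2n < m$ are the padding zeros on one side and empty inner sums on the other.
\<close>

lemma Caputo_term_sums:
  assumes "a < x"
  shows "Caputo_derivative_term \<alpha> m a x sums
    (a ^ m * (x - a) powr (\<alpha> - real m) *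
      (\<Sum>i. (diffs ^^ m) gauss_coeff i * RL_monomial (real m - \<alpha>) a i x))"
    (is "_ sums (?K * (\<Sum>i. ?d i * ?P i))")
proof -
  define T where "T i = (if i < m then 0 else ?K * (?d (i - m) * ?P (i - m)))" for i
  have "(\<lambda>i. ?K * (?d i * ?P i)) sums (?K * (\<Sum>i. ?d i * ?P i))"
    by (intro sums_mult summable_sums RL_series_summable summable_diffs_funpow assms
        sums_summable[OF gauss_coeff_sums])
  then have "(\<lambda>i. T (i + m)) sums (?K * (\<Sum>i. ?d i * ?P i))" by (simp add: T_def)
  then have "T sums (?K * (\<Sum>i. ?d i * ?P i))"
    by (subst (asm) sums_iff_shift) (simp add: T_def)
  moreover have "T i = 0" if "i \<notin> range (\<lambda>n. 2 * n)" for i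
    using gauss_coeff_eq_0[OF that] by (simp add: T_def diffs_funpow_eq)
  ultimately have "(\<lambda>n. T (2 * n)) sums (?K * (\<Sum>i. ?d i * ?P i))"
    by (subst sums_mono_reindex[OF strict_mono_double])
  moreover have "T (2 * n) = Caputo_derivative_term \<alpha> m a x n" for n
  proof (cases "m \<le> 2 * n")
    case True
    then show ?thesis using Caputo_term_eq[OF assms True] by (simp add: T_def)
  next
    case False
    then have "{k. k + m \<le> 2 * n} = {}" by auto
    with False show ?thesis by (simp add: T_def Caputo_derivative_term_def)
  qed
  ultimately show ?thesis by simp
qed

theorem theorem11:
  fixes \<alpha> a x :: real and m :: nat
  assumes "\<alpha> > 0" and "\<alpha> \<notin> \<int>" and "int m = \<lceil>\<alpha>\<rceil>"
    and "a \<noteq> 0" and "x > a"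
  defines "f \<equiv> (\<lambda>\<tau>::real. exp (- (\<tau>\<^sup>2 / 2)))"
  shows
    "(RL_integral_exists \<alpha> a f x \<and>
      summable (RL_integral_term \<alpha> a x) \<and>
      RL_integral \<alpha> a f x = (x - a) powr \<alpha> * (\<Sum>n. RL_integral_term \<alpha> a x n)) \<and>
     (RL_derivative_exists \<alpha> a f x \<and>
      summable (RL_derivative_term \<alpha> a x) \<and>
      RL_derivative \<alpha> a f x = (x - a) powr (- \<alpha>) * (\<Sum>n. RL_derivative_term \<alpha> a x n)) \<and>
     (Caputo_derivative_exists \<alpha> a f x \<and>
      summable (Caputo_derivative_term \<alpha> m a x) \<and>
      a ^ m * (x - a) powr (\<alpha> - real m) * Caputo_derivative \<alpha> a f x =
        (\<Sum>n. Caputo_derivative_term \<alpha> m a x n))"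
proof -
  have f: "f = (\<lambda>\<tau>. \<Sum>i. gauss_coeff i * \<tau> ^ i)"
    using gauss_coeff_sums by (simp add: f_def fun_eq_iff sums_iff)
  have c: "summable (\<lambda>i. gauss_coeff i * y ^ i)" for y
    using sums_summable[OF gauss_coeff_sums] .
  have m: "nat \<lceil>\<alpha>\<rceil> = m" using assms(3) by linarith
  have "\<alpha> \<noteq> real m" using assms(2) by auto
  then have \<beta>: "real m - \<alpha> > 0" using assms(3) by linarith
  have Gamma_pos: "Gamma \<alpha> > 0" "Gamma (real m - \<alpha>) > 0"
    using \<open>\<alpha> > 0\<close> \<beta> by (simp_all add: Gamma_real_pos)
  have scale: "summable g \<and> S = z powr p * (\<Sum>n. g n)"
    if "z > 0" "(\<lambda>n. z powr p * g n) sums S" for g :: "nat \<Rightarrow> real" and S z p :: real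
    using that summable_mult_D[of "z powr p" g] by (auto simp: sums_iff suminf_mult)

  have "RL_integral_exists \<alpha> a f x"
    unfolding RL_integral_exists_def f
    using RL_integral_power_series(1)[OF c \<open>\<alpha> > 0\<close> \<open>x > a\<close>] .
  moreover have "RL_integral \<alpha> a f x = (\<Sum>i. gauss_coeff i * RL_monomial \<alpha> a i x)"
    unfolding RL_integral_def f
    using RL_integral_power_series(2)[OF c \<open>\<alpha> > 0\<close> \<open>x > a\<close>] Gamma_pos by simp
  moreover note scale[OF _ RL_integral_term_sums[OF \<open>x > a\<close>, of \<alpha>]]

  moreover have "RL_derivative_exists \<alpha> a f x"
  proof -
    have "\<forall>\<^sub>F t in nhds x. t > a" using \<open>x > a\<close> by (intro eventually_nhds_in_open[of "{a<..}", simplified])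
    then show ?thesis
      unfolding RL_derivative_exists_def m Let_def f
      by eventually_elim
        (use RL_integral_power_series(1)[OF c \<beta>] RL_integral_iterated_deriv(2)[OF c \<beta>] in blast)
  qed
  moreover have "RL_derivative \<alpha> a f x = (\<Sum>i. gauss_coeff i * RL_monomial (- \<alpha>) a i x)"
    unfolding RL_derivative_def m Let_def f
    using RL_integral_iterated_deriv(1)[OF c \<beta> \<open>x > a\<close>, of m] Gamma_pos by simp
  moreover note scale[OF _ RL_integral_term_sums[OF \<open>x > a\<close>, of "- \<alpha>"]]

  moreover have "Caputo_derivative_exists \<alpha> a f x"
    unfolding Caputo_derivative_exists_def m Let_def f
    using power_series_iterated_deriv(2)[OF c]
      RL_integral_power_series(1)[OF summable_diffs_funpow[OF c, of m] \<beta> \<open>x > a\<close>]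
    by (simp add: power_series_iterated_deriv(1)[OF c])
  moreover have "Caputo_derivative \<alpha> a f x =
      (\<Sum>i. (diffs ^^ m) gauss_coeff i * RL_monomial (real m - \<alpha>) a i x)"
    unfolding Caputo_derivative_def m Let_def f power_series_iterated_deriv(1)[OF c]
    using RL_integral_power_series(2)[OF summable_diffs_funpow[OF c, of m] \<beta> \<open>x > a\<close>] Gamma_pos
    by simp
  moreover note Caputo_term_sums[OF \<open>x > a\<close>, of \<alpha> m]
  ultimately show ?thesis
    using \<open>x > a\<close> by (simp add: RL_derivative_term_eq sums_iff)
qed

end
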